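(* Let $X,Y$ be topological spaces and let $f:X\to Y$ be a continuous map. Then $\mathrm{cat}(f)\cdot\mathrm{secat}(f)\ge\mathrm{cat}(Y)$.
   Context: A continuous map is null-homotopic if it is (freely) homotopic to a constant map. The category $\mathrm{cat}(f)$ of a continuous map $f:X\to Y$ is the least positive integer $n$ such that $X$ is a union of open subsets $U_1,\dots,U_n$ with each restriction $f_{|U_i}:U_i\to Y$ null-homotopic. The LS category $\mathrm{cat}(Y)$ of a space $Y$ is the least positive integer $k$ such that $Y$ is a union of open subsets $U_1,\dots,U_k$ with each inclusion $U_j\hookrightarrow Y$ null-homotopic. The sectional category $\mathrm{secat}(f)$ is the least positive integer $k$ such that $Y$ is a union of open subsets $U_1,\dots,U_k$ and for each $j$ there is a continuous map $s_j:U_j\to X$ with $f\circ s_j$ homotopic to the inclusion $U_j\hookrightarrow Y$. Each of these invariants is $\infty$ if no such integer exists, and a product with a factor $\infty$ is $\infty$ (the other factor being at least $1$). *)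

theory Defs
  imports "HOL-Analysis.Analysis" "HOL-Library.Extended_Nat"
begin

text \<open>
  In the three invariants, a map out of an open subset \<open>U\<close> is a map out of the
  subspace \<open>subtopology X U\<close>, and the value is \<open>\<infinity>\<close> when no \<open>n\<close> qualifies, since
  the infimum of the empty set in \<^typ>\<open>enat\<close> is \<open>\<infinity>\<close>.
\<close>

text \<open>
  If \<open>X\<close> has a point, then \<open>c\<close> necessarily lies in \<open>topspace Y\<close>. The empty map counts
  as constant, so it is null-homotopic (even into the empty space).
\<close>

definition null_homotopic :: "'a topology \<Rightarrow> 'b topology \<Rightarrow> ('a \<Rightarrow> 'b) \<Rightarrow> bool" where
  "null_homotopic X Y f \<longleftrightarrow> (\<exists>c. homotopic_with (\<lambda>_. True) X Y f (\<lambda>_. c))"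

definition cat_map :: "'a topology \<Rightarrow> 'b topology \<Rightarrow> ('a \<Rightarrow> 'b) \<Rightarrow> enat" where
  "cat_map X Y f = Inf {enat n | n. n \<ge> 1 \<and>
     (\<exists>U :: nat \<Rightarrow> 'a set. (\<Union>i\<in>{1..n}. U i) = topspace X \<and>
        (\<forall>i\<in>{1..n}. openin X (U i) \<and> null_homotopic (subtopology X (U i)) Y f))}"

definition cat_space :: "'a topology \<Rightarrow> enat" where
  "cat_space Y = Inf {enat k | k. k \<ge> 1 \<and>
     (\<exists>U :: nat \<Rightarrow> 'a set. (\<Union>j\<in>{1..k}. U j) = topspace Y \<and>
        (\<forall>j\<in>{1..k}. openin Y (U j) \<and> null_homotopic (subtopology Y (U j)) Y (\<lambda>y. y)))}"

definition secat :: "'a topology \<Rightarrow> 'b topology \<Rightarrow> ('a \<Rightarrow> 'b) \<Rightarrow> enat" where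
  "secat X Y f = Inf {enat k | k. k \<ge> 1 \<and>
     (\<exists>U :: nat \<Rightarrow> 'b set. (\<Union>j\<in>{1..k}. U j) = topspace Y \<and>
        (\<forall>j\<in>{1..k}. openin Y (U j) \<and>
           (\<exists>s. continuous_map (subtopology Y (U j)) X s \<and>
                homotopic_with (\<lambda>_. True) (subtopology Y (U j)) Y (f \<circ> s) (\<lambda>y. y))))}"

end

theory Submission imports Defs begin

text \<open>
  Let \<open>f\<close> be null-homotopic on each \<open>U i\<close>, and let \<open>s j\<close> be a homotopy section of \<open>f\<close> over
  \<open>V j\<close>. On the open set \<open>W i j = {y \<in> V j. s j y \<in> U i}\<close>, the inclusion into \<open>Y\<close> is homotopic
  to \<open>f \<circ> s j\<close>, which factors through \<open>f\<close> restricted to \<open>U i\<close> and so is null-homotopic. The sets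
  \<open>W i j\<close> cover \<open>Y\<close>.
\<close>

lemma null_homotopic_compose_right:
  assumes "null_homotopic X Y f" and "continuous_map W X s"
  shows "null_homotopic W Y (f \<circ> s)"
proof -
  obtain c where "homotopic_with (\<lambda>_. True) X Y f (\<lambda>_. c)"
    using assms(1) unfolding null_homotopic_def by blast
  then have "homotopic_with (\<lambda>_. True) W Y (f \<circ> s) ((\<lambda>_. c) \<circ> s)"
    using assms(2) by (rule homotopic_with_compose_continuous_map_right) simp
  then show ?thesis
    unfolding null_homotopic_def comp_def by blast
qed

lemma null_homotopic_homotopic:
  assumes "homotopic_with (\<lambda>_. True) X Y f g" and "null_homotopic X Y f"
  shows "null_homotopic X Y g"
  using assms unfolding null_homotopic_def
  by (meson homotopic_with_symD homotopic_with_trans)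

text \<open>On the preimage of \<open>U\<close>, the map \<open>s\<close> takes values in
  \<open>U\<close>, so \<open>f \<circ> s\<close> inherits the null-homotopy of \<open>f\<close> on
  \<open>U\<close>. Restricting the homotopy \<open>hom\<close> carries this over to the
  inclusion.\<close>

lemma null_homotopic_inclusion_preimage:
  assumes s: "continuous_map (subtopology Y V) X s"
    and hom: "homotopic_with (\<lambda>_. True) (subtopology Y V) Y (f \<circ> s) (\<lambda>y. y)"
    and null: "null_homotopic (subtopology X U) Y f"
  shows "null_homotopic (subtopology Y {y \<in> topspace (subtopology Y V). s y \<in> U}) Y (\<lambda>y. y)"
    (is "null_homotopic (subtopology Y ?W) Y _")
proof -
  \<comment> \<open>\<open>?W\<close> lies inside \<open>V\<close>, so restricting to
    \<open>?W\<close> directly or by way of \<open>V\<close> gives the same space; facts about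
    \<open>V\<close> can then be restricted further.\<close>
  have W: "subtopology Y ?W = subtopology (subtopology Y V) ?W"
    unfolding subtopology_subtopology by (rule arg_cong[where f = "subtopology Y"]) auto
  have "continuous_map (subtopology Y ?W) (subtopology X U) s"
    unfolding W using continuous_map_from_subtopology[OF s, of ?W]
    by (rule continuous_map_into_subtopology) auto
  then have "null_homotopic (subtopology Y ?W) Y (f \<circ> s)"
    using null by (rule null_homotopic_compose_right[rotated])
  moreover have "homotopic_with (\<lambda>_. True) (subtopology Y ?W) Y (f \<circ> s) (\<lambda>y. y)"
    unfolding W using hom by (rule homotopic_from_subtopology)
  ultimately show ?thesis
    by (rule null_homotopic_homotopic[rotated])
qed

text \<open>A bijection from \<open>{1..card I}\<close> renumbers the cover. This allows covers
  indexed by pairs; nonemptiness of \<open>I\<close> supplies the bound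
  \<open>card I \<ge> 1\<close>.\<close>

lemma cat_space_le_card:
  assumes "finite I" and "I \<noteq> {}" and "(\<Union>i\<in>I. W i) = topspace Y"
    and "\<And>i. i \<in> I \<Longrightarrow> openin Y (W i)"
    and "\<And>i. i \<in> I \<Longrightarrow> null_homotopic (subtopology Y (W i)) Y (\<lambda>y. y)"
  shows "cat_space Y \<le> enat (card I)"
proof -
  obtain h where h: "bij_betw h {1..card I} I"
    using ex_bij_betw_nat_finite_1[OF \<open>finite I\<close>] by blast
  have img: "h ` {1..card I} = I"
    using h by (rule bij_betw_imp_surj_on)
  have "(\<Union>m\<in>{1..card I}. (W \<circ> h) m) = topspace Y"
    unfolding image_comp[symmetric] img by (rule assms(3))
  moreover have "\<forall>m\<in>{1..card I}. openin Y ((W \<circ> h) m) \<and>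
      null_homotopic (subtopology Y ((W \<circ> h) m)) Y (\<lambda>y. y)"
    using assms(4,5) img by auto
  moreover have "card I \<ge> 1"
    using assms(1,2) by (simp add: Suc_le_eq card_gt_0_iff)
  ultimately show ?thesis
    unfolding cat_space_def
    by (intro Inf_lower CollectI exI[of _ "card I"] conjI exI[of _ "W \<circ> h"] refl)
qed

text \<open>\<open>enat\<close> is well-ordered, so a nonempty set attains its infimum, while the
  empty set has infimum \<open>\<infinity>\<close>.\<close>

lemma enat_Inf_infinity_or_mem:
  fixes A :: "enat set"
  shows "Inf A = \<infinity> \<or> Inf A \<in> A"
proof (cases "A = {}")
  case True
  then show ?thesis by (simp add: top_enat_def)
next
  case False
  then obtain a where "a \<in> A" by blast
  then show ?thesis by (simp add: wellorder_InfI)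
qed

text \<open>A finite value is attained, so it comes with a cover of exactly that many sets.\<close>

lemma cat_map_cases:
  obtains "cat_map X Y f = \<infinity>"
  | n U where "cat_map X Y f = enat n" "n \<ge> 1" "(\<Union>i\<in>{1..n}. U i) = topspace X"
      "\<And>i. i \<in> {1..n} \<Longrightarrow> openin X (U i)"
      "\<And>i. i \<in> {1..n} \<Longrightarrow> null_homotopic (subtopology X (U i)) Y f"
proof -
  let ?P = "\<lambda>n U. (\<Union>i\<in>{1..n}. U i) = topspace X \<and>
      (\<forall>i\<in>{1..n}. openin X (U i) \<and> null_homotopic (subtopology X (U i)) Y f)"
  have "cat_map X Y f = \<infinity> \<or>
      cat_map X Y f \<in> {enat n | n. n \<ge> 1 \<and> (\<exists>U :: nat \<Rightarrow> _ set. ?P n U)}"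
    unfolding cat_map_def by (rule enat_Inf_infinity_or_mem)
  then show thesis
  proof
    assume "cat_map X Y f = \<infinity>"
    then show thesis by (rule that(1))
  next
    assume "cat_map X Y f \<in> {enat n | n. n \<ge> 1 \<and> (\<exists>U :: nat \<Rightarrow> _ set. ?P n U)}"
    then obtain n U where n: "cat_map X Y f = enat n" "n \<ge> 1" and U: "?P n U"
      unfolding mem_Collect_eq by (elim exE conjE) (rule that, (assumption | rule conjI)+)
    show thesis
      by (rule that(2)[OF n, of U]) (use U in simp_all)
  qed
qed

text \<open>As for \<open>cat_map\<close>, with the homotopy sections gathered into one family
  \<open>s\<close> indexed by \<open>j\<close>.\<close>

lemma secat_cases:
  obtains "secat X Y f = \<infinity>"
  | k V s where "secat X Y f = enat k" "k \<ge> 1" "(\<Union>j\<in>{1..k}. V j) = topspace Y"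
      "\<And>j. j \<in> {1..k} \<Longrightarrow> openin Y (V j)"
      "\<And>j. j \<in> {1..k} \<Longrightarrow> continuous_map (subtopology Y (V j)) X (s j)"
      "\<And>j. j \<in> {1..k} \<Longrightarrow>
        homotopic_with (\<lambda>_. True) (subtopology Y (V j)) Y (f \<circ> s j) (\<lambda>y. y)"
proof -
  let ?Q = "\<lambda>V s. continuous_map (subtopology Y V) X s \<and>
      homotopic_with (\<lambda>_. True) (subtopology Y V) Y (f \<circ> s) (\<lambda>y. y)"
  let ?P = "\<lambda>k V. (\<Union>j\<in>{1..k}. V j) = topspace Y \<and>
      (\<forall>j\<in>{1..k}. openin Y (V j) \<and> (\<exists>s. ?Q (V j) s))"
  have "secat X Y f = \<infinity> \<or>
      secat X Y f \<in> {enat k | k. k \<ge> 1 \<and> (\<exists>V :: nat \<Rightarrow> _ set. ?P k V)}"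
    unfolding secat_def by (rule enat_Inf_infinity_or_mem)
  then show thesis
  proof
    assume "secat X Y f = \<infinity>"
    then show thesis by (rule that(1))
  next
    assume "secat X Y f \<in> {enat k | k. k \<ge> 1 \<and> (\<exists>V :: nat \<Rightarrow> _ set. ?P k V)}"
    then obtain k V where k: "secat X Y f = enat k" "k \<ge> 1" and V: "?P k V"
      unfolding mem_Collect_eq by (elim exE conjE) (rule that, (assumption | rule conjI)+)
    from V have "\<forall>j\<in>{1..k}. \<exists>s. ?Q (V j) s" by simp
    then obtain s where s: "\<forall>j\<in>{1..k}. ?Q (V j) (s j)"
      by (rule bchoice[THEN exE])
    show thesis
      by (rule that(2)[OF k, of V s]) (use V s in simp_all)
  qed
qed

theorem mainTheorem5:
  fixes X :: "'a topology" and Y :: "'b topology" and f :: "'a \<Rightarrow> 'b"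
  assumes "continuous_map X Y f"
  shows "cat_map X Y f * secat X Y f \<ge> cat_space Y"
proof (cases X Y f rule: cat_map_cases)
  case 1
  \<comment> \<open>In \<open>enat\<close>, \<open>\<infinity> * 0 = 0\<close>, so an infinite
    product requires the other factor to be nonzero.\<close>
  have "secat X Y f \<noteq> 0"
    by (cases X Y f rule: secat_cases) (auto simp: zero_enat_def)
  with 1 have "cat_map X Y f * secat X Y f = \<infinity>"
    by (simp add: imult_is_infinity)
  then show ?thesis by simp
next
  case (2 n U)
  show ?thesis
  proof (cases X Y f rule: secat_cases)
    case 1
    with 2(1,2) have "cat_map X Y f * secat X Y f = \<infinity>"
      by (simp add: imult_is_infinity zero_enat_def)
    then show ?thesis by simp
  next
    case sec: (2 k V s)
    define W where "W = (\<lambda>(i, j). {y \<in> topspace (subtopology Y (V j)). s j y \<in> U i})"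
    have "openin Y (W (i, j))" if "i \<in> {1..n}" "j \<in> {1..k}" for i j
    proof -
      \<comment> \<open>Continuity of \<open>s j\<close> only gives openness relative to
        \<open>V j\<close>; openness of \<open>V j\<close> in \<open>Y\<close> then lifts it to
        \<open>Y\<close>.\<close>
      have "openin (subtopology Y (V j)) (W (i, j))"
        unfolding W_def using openin_continuous_map_preimage[OF sec(5)[OF that(2)] 2(4)[OF that(1)]]
        by simp
      then show ?thesis
        using sec(4)[OF that(2)] by (rule openin_trans_full)
    qed
    moreover have "null_homotopic (subtopology Y (W (i, j))) Y (\<lambda>y. y)"
      if "i \<in> {1..n}" "j \<in> {1..k}" for i j
      unfolding W_def
      using null_homotopic_inclusion_preimage[OF sec(5)[OF that(2)] sec(6)[OF that(2)] 2(5)[OF that(1)]]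
      by simp
    moreover have "(\<Union>p\<in>{1..n} \<times> {1..k}. W p) = topspace Y"
    proof
      show "(\<Union>p\<in>{1..n} \<times> {1..k}. W p) \<subseteq> topspace Y"
        by (auto simp: W_def)
      show "topspace Y \<subseteq> (\<Union>p\<in>{1..n} \<times> {1..k}. W p)"
      proof
        fix y assume y: "y \<in> topspace Y"
        then obtain j where j: "j \<in> {1..k}" "y \<in> V j" using sec(3) by blast
        then have yj: "y \<in> topspace (subtopology Y (V j))" using y by simp
        \<comment> \<open>The index \<open>i\<close> for \<open>y\<close> is found by locating
          \<open>s j y\<close> in the cover \<open>U\<close> of \<open>X\<close>.\<close>
        then have "s j y \<in> topspace X"
          using continuous_map_image_subset_topspace[OF sec(5)[OF j(1)]] by blast
        then obtain i where "i \<in> {1..n}" "s j y \<in> U i" using 2(3) by blast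
        with j(1) yj have "y \<in> W (i, j)" "(i, j) \<in> {1..n} \<times> {1..k}" by (auto simp: W_def)
        then show "y \<in> (\<Union>p\<in>{1..n} \<times> {1..k}. W p)" by blast
      qed
    qed
    \<comment> \<open>The index set has \<open>n * k\<close> elements, and is nonempty since
      \<open>n\<close> and \<open>k\<close> are at least 1.\<close>
    ultimately have "cat_space Y \<le> enat (card ({1..n} \<times> {1..k}))"
      using 2(2) sec(2) by (intro cat_space_le_card[where W = W]) auto
    then show ?thesis
      using 2(1) sec(1) by simp
  qed
qed

end
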